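(* Let $(H,\circ)$ be a hypergroupoid and let $f$ be a fuzzy subset of $H$. Then $f$ is a fuzzy left ideal of $H$ if and only if $1\circ f\preceq f$.
   Context: A hypergroupoid $(H,\circ)$ is a nonempty set $H$ with a map $\circ: H\times H\to \mathcal{P}^*(H)$, $(a,b)\mapsto a\circ b$, where $\mathcal{P}^*(H)$ is the set of nonempty subsets of $H$. A fuzzy subset of $H$ is a map $f:H\to[0,1]$ into the real unit interval. For $a\in H$ put $A_a:=\{(y,z)\in H\times H \mid a\in y\circ z\}$. For fuzzy subsets $f,g$ of $H$, the fuzzy subset $f\circ g$ is defined by $(f\circ g)(a):=\bigvee_{(y,z)\in A_a}\min\{f(y),g(z)\}$ (supremum) if $A_a\neq\emptyset$, and $(f\circ g)(a):=0$ if $A_a=\emptyset$. The order on fuzzy subsets is $f\preceq g$ if and only if $f(x)\le g(x)$ for every $x\in H$. The symbol $1$ denotes the constant fuzzy subset $1(x):=1$ for all $x\in H$. A fuzzy subset $f$ of $H$ is called a fuzzy left ideal of $H$ if for all $x,y\in H$ and all $u\in x\circ y$ one has $f(u)\ge f(y)$. *)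

theory Defs
  imports Complex_Main "HOL-Library.FuncSet"
begin

definition hypergroupoid :: "'a set \<Rightarrow> ('a \<Rightarrow> 'a \<Rightarrow> 'a set) \<Rightarrow> bool" where
  "hypergroupoid H hop \<longleftrightarrow> H \<noteq> {} \<and> hop \<in> H \<rightarrow> H \<rightarrow> Pow H - {{}}"

text \<open>Maps from the carrier H to [0,1] are represented by total functions; all notions below
  look only at their values on H.\<close>

definition fuzzy_subset :: "'a set \<Rightarrow> ('a \<Rightarrow> real) \<Rightarrow> bool" where
  "fuzzy_subset H f \<longleftrightarrow> f \<in> H \<rightarrow> {0..1}"

definition factor_pairs :: "'a set \<Rightarrow> ('a \<Rightarrow> 'a \<Rightarrow> 'a set) \<Rightarrow> 'a \<Rightarrow> ('a \<times> 'a) set" where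
  "factor_pairs H hop a = {(y, z) \<in> H \<times> H. a \<in> hop y z}"

text \<open>The real supremum below is the genuine one: for fuzzy subsets it is taken over a nonempty
  subset of [0,1].\<close>

definition fuzzy_prod ::
  "'a set \<Rightarrow> ('a \<Rightarrow> 'a \<Rightarrow> 'a set) \<Rightarrow> ('a \<Rightarrow> real) \<Rightarrow> ('a \<Rightarrow> real) \<Rightarrow> 'a \<Rightarrow> real" where
  "fuzzy_prod H hop f g a =
    (if factor_pairs H hop a \<noteq> {}
     then (SUP (y, z) \<in> factor_pairs H hop a. min (f y) (g z)) else 0)"

definition fuzzy_le :: "'a set \<Rightarrow> ('a \<Rightarrow> real) \<Rightarrow> ('a \<Rightarrow> real) \<Rightarrow> bool" where
  "fuzzy_le H f g \<longleftrightarrow> (\<forall>x\<in>H. f x \<le> g x)"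

definition fuzzy_one :: "'a \<Rightarrow> real" where
  "fuzzy_one x = 1"

definition fuzzy_left_ideal :: "'a set \<Rightarrow> ('a \<Rightarrow> 'a \<Rightarrow> 'a set) \<Rightarrow> ('a \<Rightarrow> real) \<Rightarrow> bool" where
  "fuzzy_left_ideal H hop f \<longleftrightarrow>
    fuzzy_subset H f \<and> (\<forall>x\<in>H. \<forall>y\<in>H. \<forall>u\<in>hop x y. f u \<ge> f y)"

end

theory Submission
  imports Defs
begin

text \<open>A supremum lies below a bound exactly when all its members do. So the product with
  \<open>fuzzy_one\<close> lies below \<open>f\<close> iff \<open>min 1 (f z) \<le> f a\<close>
  whenever \<open>a \<in> hop y z\<close>. As \<open>f z \<le> 1\<close>, the minimum is
  \<open>f z\<close>, which leaves the left ideal inequality. \<open>fuzzy_prod_le_iff\<close>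
  supplies the passage from the supremum to its members.\<close>

lemma fuzzy_prod_le_iff:
  assumes "fuzzy_subset H f" "fuzzy_subset H g" "0 \<le> c"
  shows "fuzzy_prod H hop f g a \<le> c \<longleftrightarrow>
    (\<forall>y\<in>H. \<forall>z\<in>H. a \<in> hop y z \<longrightarrow> min (f y) (g z) \<le> c)"
proof (cases "factor_pairs H hop a = {}")
  case True
  \<comment> \<open>With no factorization the right side is vacuous and the product takes its
    default value 0, so \<open>0 \<le> c\<close> decides the case.\<close>
  then show ?thesis
    using assms(3) by (auto simp: fuzzy_prod_def factor_pairs_def)
next
  case False
  \<comment> \<open>The reals are only conditionally complete: \<open>cSUP_le_iff\<close> requires
    an upper bound, and \<open>f \<le> 1\<close> on \<open>H\<close> gives one.\<close>
  have "min (f y) (g z) \<le> 1" if "(y, z) \<in> factor_pairs H hop a" for y z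
    using that assms(1) by (auto simp: factor_pairs_def fuzzy_subset_def min_le_iff_disj)
  then have "bdd_above ((\<lambda>(y, z). min (f y) (g z)) ` factor_pairs H hop a)"
    by (intro bdd_aboveI2[where M = 1]) auto
  with False have "fuzzy_prod H hop f g a \<le> c \<longleftrightarrow>
      (\<forall>p\<in>factor_pairs H hop a. (\<lambda>(y, z). min (f y) (g z)) p \<le> c)"
    by (simp add: fuzzy_prod_def cSUP_le_iff)
  also have "\<dots> \<longleftrightarrow> (\<forall>y\<in>H. \<forall>z\<in>H. a \<in> hop y z \<longrightarrow> min (f y) (g z) \<le> c)"
    by (auto simp: factor_pairs_def)
  finally show ?thesis .
qed

theorem theorem6:
  fixes H :: "'a set" and hop :: "'a \<Rightarrow> 'a \<Rightarrow> 'a set" and f :: "'a \<Rightarrow> real"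
  assumes "hypergroupoid H hop" and "fuzzy_subset H f"
  shows "fuzzy_left_ideal H hop f \<longleftrightarrow> fuzzy_le H (fuzzy_prod H hop fuzzy_one f) f"
proof -
  \<comment> \<open>The order tests only points of \<open>H\<close>, whereas the ideal condition
    ranges over all of \<open>hop x y\<close>; closure reconciles the two.\<close>
  have sub: "hop x y \<subseteq> H" if "x \<in> H" "y \<in> H" for x y
    using assms(1) that unfolding hypergroupoid_def by blast
  have f: "0 \<le> f x" "f x \<le> 1" if "x \<in> H" for x
    using assms(2) that by (auto simp: fuzzy_subset_def Pi_iff)
  have one: "fuzzy_subset H fuzzy_one"
    by (simp add: fuzzy_subset_def fuzzy_one_def)
  have "fuzzy_le H (fuzzy_prod H hop fuzzy_one f) f \<longleftrightarrow>
      (\<forall>a\<in>H. \<forall>y\<in>H. \<forall>z\<in>H. a \<in> hop y z \<longrightarrow> min (fuzzy_one y) (f z) \<le> f a)"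
    by (simp add: fuzzy_le_def fuzzy_prod_le_iff[OF one assms(2)] f)
  also have "\<dots> \<longleftrightarrow> (\<forall>a\<in>H. \<forall>y\<in>H. \<forall>z\<in>H. a \<in> hop y z \<longrightarrow> f z \<le> f a)"
    by (simp add: fuzzy_one_def f min_absorb2)
  also have "\<dots> \<longleftrightarrow> fuzzy_left_ideal H hop f"
    unfolding fuzzy_left_ideal_def using assms(2) sub by blast
  finally show ?thesis by simp
qed

end
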